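(* Let $h$ be a positive integer such that $h \bmod 8 \in \{0,1,4,5\}$. The triangular grid $T_h$ is balanceable if and only if $h \bmod 8\in\{0,1\}$.
   Context: All graphs are simple and finite. $T_h$ is the (equilateral) triangular grid with $h$ vertices on each side: its vertices are $u_i^j$ with $1\le i\le j\le h$ ($u_i^j$ being the $i$th vertex from the left in the $j$th row from the top), and its edges are $u_i^ju_{i+1}^j$ (for $1\le i<j\le h$), $u_i^ju_i^{j+1}$ and $u_i^ju_{i+1}^{j+1}$ (for $1\le i\le j<h$). It has $\frac{3(h-1)h}{2}$ edges, which is even exactly when $h\bmod 8\in\{0,1,4,5\}$. A 2-coloring of the edges of $K_n$ is a function $\alpha:E(K_n)\to\{R,B\}$. It contains a balanced copy of a graph $G$ if $K_n$ has a (not necessarily induced) subgraph isomorphic to $G$ whose edge set is partitioned into $E_1,E_2$ with $\alpha(e)=R$ for $e\in E_1$, $\alpha(e)=B$ for $e\in E_2$, and $\big||E_1|-|E_2|\big|\le 1$. A graph $G$ is balanceable if there is an $n_0$ such that for every $n\ge n_0$ there exists an integer $m$ with $0\le m<\lfloor \frac12\binom n2\rfloor$ such that every 2-coloring $\alpha$ of $E(K_n)$ with $|\alpha^{-1}(R)|>m$ and $|\alpha^{-1}(B)|>m$ contains a balanced copy of $G$. *)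

theory Defs
  imports Complex_Main
begin

record 'a ugraph =
  verts :: "'a set"
  edges :: "'a set set"

definition simple_graph :: "'a ugraph \<Rightarrow> bool" where
  "simple_graph G \<longleftrightarrow>
     finite (verts G) \<and> (\<forall>e\<in>edges G. e \<subseteq> verts G \<and> card e = 2)"

definition subgraph :: "'a ugraph \<Rightarrow> 'a ugraph \<Rightarrow> bool" where
  "subgraph H G \<longleftrightarrow>
     simple_graph H \<and> verts H \<subseteq> verts G \<and> edges H \<subseteq> edges G"

definition isomorphic :: "'a ugraph \<Rightarrow> 'b ugraph \<Rightarrow> bool" where
  "isomorphic G H \<longleftrightarrow>
     (\<exists>f. bij_betw f (verts G) (verts H) \<and>
          (\<forall>u\<in>verts G. \<forall>v\<in>verts G. {u, v} \<in> edges G \<longleftrightarrow> {f u, f v} \<in> edges H))"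

definition complete_graph :: "nat \<Rightarrow> nat ugraph" where
  "complete_graph n =
     \<lparr>verts = {..<n}, edges = {e. e \<subseteq> {..<n} \<and> card e = 2}\<rparr>"

text \<open>The pair \<open>(i, j)\<close> is the \<open>i\<close>th vertex from the left in the \<open>j\<close>th row
  from the top.\<close>

definition triangular_grid :: "nat \<Rightarrow> (nat \<times> nat) ugraph" where
  "triangular_grid h =
     \<lparr>verts = {(i, j). 1 \<le> i \<and> i \<le> j \<and> j \<le> h},
      edges = {{(i, j), (i + 1, j)} | i j. 1 \<le> i \<and> i < j \<and> j \<le> h}
            \<union> {{(i, j), (i, j + 1)} | i j. 1 \<le> i \<and> i \<le> j \<and> j < h}
            \<union> {{(i, j), (i + 1, j + 1)} | i j. 1 \<le> i \<and> i \<le> j \<and> j < h}\<rparr>"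

datatype color = Red | Blue

text \<open>A 2-coloring is represented by a total function on sets of naturals; only its values
  on the edges of the complete graph are ever used.\<close>

definition color_class :: "nat \<Rightarrow> (nat set \<Rightarrow> color) \<Rightarrow> color \<Rightarrow> nat set set" where
  "color_class n \<alpha> c = {e \<in> edges (complete_graph n). \<alpha> e = c}"

definition contains_balanced_copy ::
  "nat \<Rightarrow> (nat set \<Rightarrow> color) \<Rightarrow> 'a ugraph \<Rightarrow> bool" where
  "contains_balanced_copy n \<alpha> G \<longleftrightarrow>
     (\<exists>H E1 E2. subgraph H (complete_graph n) \<and> isomorphic G H \<and>
        edges H = E1 \<union> E2 \<and> E1 \<inter> E2 = {} \<and>
        (\<forall>e\<in>E1. \<alpha> e = Red) \<and> (\<forall>e\<in>E2. \<alpha> e = Blue) \<and>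
        \<bar>int (card E1) - int (card E2)\<bar> \<le> 1)"

definition balanceable :: "'a ugraph \<Rightarrow> bool" where
  "balanceable G \<longleftrightarrow>
     (\<exists>n0. \<forall>n\<ge>n0. \<exists>m. m < (n choose 2) div 2 \<and>
        (\<forall>\<alpha>. card (color_class n \<alpha> Red) > m \<and> card (color_class n \<alpha> Blue) > m
              \<longrightarrow> contains_balanced_copy n \<alpha> G))"

lemma simple_graph_complete_graph: "simple_graph (complete_graph n)"
  by (simp add: simple_graph_def complete_graph_def)

lemma simple_graph_triangular_grid: "simple_graph (triangular_grid h)"
proof -
  have "finite (verts (triangular_grid h))"
    by (rule finite_subset[of _ "{..h} \<times> {..h}"]) (auto simp: triangular_grid_def)
  moreover have "\<forall>e\<in>edges (triangular_grid h). e \<subseteq> verts (triangular_grid h) \<and> card e = 2"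
    by (auto simp: triangular_grid_def)
  ultimately show ?thesis
    by (simp add: simple_graph_def)
qed

end

theory Submission
  imports Defs "HOL-Library.Ramsey"
begin

text \<open>Taking \<open>m\<close> just below half of the edges, only colorings with both classes dense matter.
  Each color class then contains a large complete bipartite graph, and Ramsey's theorem inside the
  parts yields two disjoint large cliques, each monochromatic and with a monochromatic cut between
  them, not all of one color. So a graph is balanceable as soon as some vertex set induces exactly
  half of its edges and some vertex cut contains exactly half of them. Conversely, for square \<open>n\<close>
  some cut contains exactly half of the edges of the complete graph, so a balanceable graph with an
  even number of edges has a cut with half of its edges.

  The edges of \<open>T\<^sub>h\<close> split into the \<open>h (h - 1) / 2\<close> upward triangles, and a cut meets each triangle in
  0 or 2 edges. Hence every cut is even, while half of the number of edges is odd if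
  \<open>h mod 8 \<in> {4, 5}\<close>. If \<open>h mod 8 \<in> {0, 1}\<close>, the cut of a union of rows has \<open>2j\<close> edges for each
  \<open>j\<close> such that the rows \<open>j\<close> and \<open>j + 1\<close> are separated. These \<open>j\<close> can form any subset of
  \<open>{1..<h}\<close>, so every even size is attained. Adding vertices row by row to the first \<open>k\<close> rows creates
  1, 3, ..., 3, 2 new edges per row, so an initial segment ending inside a row induces \<open>1\<close> modulo 3
  edges; as the first two rows meet 7 edges of the first three rows, deleting them corrects this
  to \<open>0\<close> modulo 3, and then every large multiple of 3 is attained.\<close>

section \<open>Unavoidable patterns in dense colorings\<close>

text \<open>Pigeonhole over the \<open>2 ^ card X\<close> possible values of \<open>S\<close>: some
  value \<open>A\<close> is taken at least \<open>t\<close> times, and it has at least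
  \<open>t\<close> elements itself. This is the step that turns many large neighbourhoods inside a
  bounded set into a complete bipartite graph.\<close>

lemma common_subset_pigeonhole:
  fixes S :: "'b \<Rightarrow> 'a set"
  assumes "finite X" "finite W"
    and S: "\<And>w. w \<in> W \<Longrightarrow> S w \<subseteq> X" "\<And>w. w \<in> W \<Longrightarrow> t \<le> card (S w)"
    and large: "t * 2 ^ card X \<le> card W"
  obtains Y Z where "Y \<subseteq> X" "card Y = t" "Z \<subseteq> W" "card Z = t" "\<And>z. z \<in> Z \<Longrightarrow> Y \<subseteq> S z"
proof (cases "t = 0")
  case True
  then show ?thesis using that[of "{}" "{}"] by simp
next
  case False
  have "\<exists>A\<in>Pow X. t \<le> card {w \<in> W. S w = A}"
  proof (rule ccontr)
    assume neg: "\<not> (\<exists>A\<in>Pow X. t \<le> card {w \<in> W. S w = A})"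
    have "card W = (\<Sum>A\<in>Pow X. card {w \<in> W. S w = A})"
      using sum_fun_comp[of W "Pow X" S "\<lambda>_. 1::nat"] assms by (auto simp: image_subset_iff)
    also have "\<dots> < (\<Sum>A\<in>Pow X. t)"
      by (rule sum_strict_mono) (use assms(1) neg in \<open>auto simp: not_le\<close>)
    also have "\<dots> = t * 2 ^ card X"
      using assms(1) by (simp add: card_Pow)
    finally show False using large by simp
  qed
  then obtain A where A: "t \<le> card {w \<in> W. S w = A}" by blast
  then obtain w where "w \<in> W" "S w = A" using False
    by (metis (mono_tags, lifting) card.empty empty_Collect_eq le_zero_eq)
  then obtain Y where "Y \<subseteq> A" "card Y = t" "A \<subseteq> X"
    using S by (metis obtain_subset_with_card_n)
  moreover obtain Z where "Z \<subseteq> {w \<in> W. S w = A}" "card Z = t"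
    using obtain_subset_with_card_n[OF A] by blast
  ultimately show ?thesis using that[of Y Z] by auto
qed

text \<open>A Markov-type bound: an index reaching the threshold \<open>t\<close> is charged
  \<open>M\<close>, and every index is charged \<open>t\<close> for the remainder. Read backwards, a
  large sum forces many heavy indices.\<close>

lemma sum_le_heavy:
  fixes f :: "'a \<Rightarrow> nat"
  assumes "finite I" "\<And>i. i \<in> I \<Longrightarrow> f i \<le> M"
  shows "sum f I \<le> card {i \<in> I. t \<le> f i} * M + card I * t"
proof -
  have "sum f I \<le> (\<Sum>i\<in>I. (if t \<le> f i then M else 0) + t)"
    by (rule sum_mono) (use assms in \<open>auto simp: trans_le_add1\<close>)
  also have "\<dots> = card {i \<in> I. t \<le> f i} * M + card I * t"
    using assms(1) by (simp add: sum.distrib flip: sum.inter_filter)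
  finally show ?thesis .
qed

lemma ramsey_monochromatic:
  "\<exists>r\<ge>t. \<forall>(V::'a set) (\<alpha>::'a set \<Rightarrow> color). finite V \<and> r \<le> card V \<longrightarrow>
     (\<exists>c S. S \<subseteq> V \<and> card S = t \<and> (\<forall>x\<in>S. \<forall>y\<in>S. x \<noteq> y \<longrightarrow> \<alpha> {x, y} = c))"
proof -
  obtain r where r: "\<And>(V::'a set) E. \<lbrakk>finite V; r \<le> card V\<rbrakk> \<Longrightarrow>
      \<exists>S\<subseteq>V. card S = t \<and> clique S E \<or> card S = t \<and> indep S E"
    using ramsey2[of t t] by metis
  have "\<exists>c S. S \<subseteq> V \<and> card S = t \<and> (\<forall>x\<in>S. \<forall>y\<in>S. x \<noteq> y \<longrightarrow> \<alpha> {x, y} = c)"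
    if V: "finite V" "max r t \<le> card V" for V :: "'a set" and \<alpha> :: "'a set \<Rightarrow> color"
  proof -
    obtain S where S: "S \<subseteq> V" "card S = t"
      and or: "clique S {e. \<alpha> e = Red} \<or> indep S {e. \<alpha> e = Red}"
      using r[of V "{e. \<alpha> e = Red}"] V by auto
    show ?thesis
    proof (cases "clique S {e. \<alpha> e = Red}")
      case True
      then show ?thesis using S by (auto simp: clique_def)
    next
      case False
      then have "\<forall>x\<in>S. \<forall>y\<in>S. x \<noteq> y \<longrightarrow> \<alpha> {x, y} = Blue"
        using or by (auto simp: indep_def) (metis color.exhaust)
      then show ?thesis using S by blast
    qed
  qed
  then show ?thesis by (intro exI[of _ "max r t"]) auto
qed

text \<open>Fix \<open>2 * t\<close> vertices \<open>X\<close> of \<open>A\<close>. Each vertex of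
  \<open>B\<close> sends one color to at least \<open>t\<close> of them, and at least half of
  \<open>B\<close> agrees on such a color. The pigeonhole over subsets of \<open>X\<close> then
  applies; in the bound, the outer factor 2 pays for the choice of color.\<close>

lemma bipartite_ramsey:
  "\<exists>r\<ge>t. \<forall>(A::'a set) B (\<alpha>::'a set \<Rightarrow> color).
     finite A \<and> finite B \<and> r \<le> card A \<and> r \<le> card B \<longrightarrow>
     (\<exists>c A' B'. A' \<subseteq> A \<and> B' \<subseteq> B \<and> card A' = t \<and> card B' = t \<and>
        (\<forall>x\<in>A'. \<forall>y\<in>B'. \<alpha> {x, y} = c))"
proof (rule exI[of _ "2 * (t * 2 ^ (2 * t))"], intro conjI allI impI, goal_cases)
  case 1
  have "t * 1 \<le> t * (2 * 2 ^ (2 * t))" by (intro mult_le_mono) auto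
  then show ?case by simp
next
  case (2 A B \<alpha>)
  let ?r = "2 * (t * 2 ^ (2 * t))"
  have "2 * t \<le> ?r" by simp
  then obtain X where X: "X \<subseteq> A" "card X = 2 * t" "finite X"
    using 2 by (meson obtain_subset_with_card_n le_trans finite_subset)
  define S where "S c y = {x \<in> X. \<alpha> {x, y} = c}" for c y
  define W where "W c = {y \<in> B. t \<le> card (S c y)}" for c
  have "card (S Red y) + card (S Blue y) = 2 * t" for y
  proof -
    have "S Red y \<union> S Blue y = X" using color.exhaust by (auto simp: S_def)
    moreover have "S Red y \<inter> S Blue y = {}" by (auto simp: S_def)
    ultimately show ?thesis using X
      by (metis card_Un_disjoint finite_Un)
  qed
  then have "t \<le> card (S Red y) \<or> t \<le> card (S Blue y)" for y
    by (metis add_less_mono linorder_not_le mult_2 nat_neq_iff)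
  then have "B = W Red \<union> W Blue" by (auto simp: W_def)
  then have "card B \<le> card (W Red) + card (W Blue)"
    by (metis card_Un_le)
  then have "t * 2 ^ (2 * t) \<le> card (W Red) \<or> t * 2 ^ (2 * t) \<le> card (W Blue)"
    using 2 by linarith
  then obtain c where c: "t * 2 ^ (2 * t) \<le> card (W c)" by blast
  obtain Y Z where YZ: "Y \<subseteq> X" "card Y = t" "Z \<subseteq> W c" "card Z = t" "\<And>z. z \<in> Z \<Longrightarrow> Y \<subseteq> S c z"
    by (rule common_subset_pigeonhole[of X "W c" "S c" t])
      (use 2 X c in \<open>auto simp: S_def W_def\<close>)
  then have "\<forall>x\<in>Y. \<forall>y\<in>Z. \<alpha> {x, y} = c" by (auto simp: S_def)
  moreover have "Y \<subseteq> A" "Z \<subseteq> B" using YZ X by (auto simp: W_def)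
  ultimately show ?case using YZ by blast
qed

text \<open>A double counting in the style of Kovari, Sos and Turan: find many vertices of linear
  degree in the color, keep a bounded number \<open>32 * t\<close> of them, and show that linearly
  many vertices see at least \<open>t\<close> of those.\<close>

lemma dense_color_class_biclique:
  "\<exists>n0. \<forall>n\<ge>n0. \<forall>\<alpha> c. (n choose 2) div 2 \<le> card (color_class n \<alpha> c) \<longrightarrow>
     (\<exists>P Q. P \<subseteq> {..<n} \<and> Q \<subseteq> {..<n} \<and> card P = t \<and> card Q = t \<and>
        (\<forall>x\<in>P. \<forall>y\<in>Q. x \<noteq> y \<and> \<alpha> {x, y} = c))"
\<comment> \<open>The term \<open>512 * t\<close> gives \<open>n div 16 \<ge> 32 * t\<close>, the
  term 100 absorbs rounding in the edge count, and the first term makes \<open>W\<close> large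
  enough for the pigeonhole.\<close>
proof (rule exI[of _ "32 * (t * 2 ^ (32 * t)) + 100 + 512 * t"], intro allI impI, goal_cases)
  case (1 n \<alpha> c)
  \<comment> \<open>Only larger neighbours are listed, so each edge is counted once, and the two
    sides of the final biclique are automatically disjoint.\<close>
  define N where "N u = {v. u < v \<and> v < n \<and> \<alpha> {u, v} = c}" for u
  have finN: "finite (N u)" for u by (auto simp: N_def)
  have Nn: "card (N u) \<le> n" for u
    using card_mono[of "{..<n}" "N u"] by (auto simp: N_def)
  have "color_class n \<alpha> c \<subseteq> (\<lambda>(u, v). {u, v}) ` (SIGMA u:{..<n}. N u)"
  proof
    fix e assume "e \<in> color_class n \<alpha> c"
    then obtain u v where e: "e = {u, v}" "u < n" "v < n" "u \<noteq> v" "\<alpha> e = c"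
      by (auto simp: color_class_def complete_graph_def card_2_iff)
    then have "(u, v) \<in> (SIGMA u:{..<n}. N u) \<or> (v, u) \<in> (SIGMA u:{..<n}. N u)"
      by (auto simp: N_def insert_commute)
    then show "e \<in> (\<lambda>(u, v). {u, v}) ` (SIGMA u:{..<n}. N u)"
      using e by (auto simp: image_iff insert_commute)
  qed
  then have "card (color_class n \<alpha> c) \<le> card (SIGMA u:{..<n}. N u)"
    using finN by (meson surj_card_le finite_SigmaI finite_lessThan)
  also have "\<dots> = (\<Sum>u<n. card (N u))" using finN by simp
  also have "\<dots> \<le> card {u \<in> {..<n}. n div 16 \<le> card (N u)} * n + n * (n div 16)"
    using sum_le_heavy[of "{..<n}" "\<lambda>u. card (N u)" n "n div 16"] Nn by simp
  finally have *: "(n choose 2) div 2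
      \<le> card {u \<in> {..<n}. n div 16 \<le> card (N u)} * n + n * (n div 16)" using 1 by simp
  define H where "H = {u \<in> {..<n}. n div 16 \<le> card (N u)}"
  \<comment> \<open>Otherwise the bound \<open>*\<close> leaves at most \<open>n * n div 8\<close>
    edges, only about half of the roughly \<open>n * n / 4\<close> edges present.\<close>
  have "n div 16 \<le> card H"
  proof (rule ccontr)
    assume "\<not> n div 16 \<le> card H"
    then have "card H * n + n * (n div 16) \<le> (n div 16 + n div 16) * n"
      by (simp add: algebra_simps)
    also have "\<dots> \<le> n * n div 8"
    proof -
      have "8 * (n div 16 + n div 16) \<le> n" by simp
      then have "8 * (n div 16 + n div 16) * n \<le> n * n" by (rule mult_le_mono1)
      then show ?thesis by linarith
    qed
    finally have a: "(n choose 2) div 2 \<le> n * n div 8" using * unfolding H_def by linarith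
    have "n * (n - 1) div 2 = n choose 2" by (simp add: choose_two)
    moreover have "n * (n - 1) + n = n * n" by (cases n) auto
    moreover have "100 * n \<le> n * n" using 1 by (intro mult_le_mono1) simp
    moreover have "n \<ge> 100" using 1 by simp
    ultimately show False using a by linarith
  qed
  then have "32 * t \<le> card H" using 1 by linarith
  then obtain X where X: "X \<subseteq> H" "card X = 32 * t"
    by (metis obtain_subset_with_card_n)
  then have Xn: "X \<subseteq> {..<n}" by (auto simp: H_def)
  have finX: "finite X" using Xn by (rule finite_subset) simp
  define S where "S w = {u \<in> X. w \<in> N u}" for w
  define W where "W = {w \<in> {..<n}. t \<le> card (S w)}"
  \<comment> \<open>Count pairs of \<open>u\<close> in \<open>X\<close> and \<open>w\<close> in
    \<open>N u\<close>. There are at least about \<open>2 * t * n\<close> of them; the vertices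
    outside \<open>W\<close> account for at most \<open>t * n\<close>, and each vertex of
    \<open>W\<close> for at most \<open>32 * t\<close>, so \<open>W\<close> has at least about
    \<open>n / 32\<close> elements.\<close>
  have "32 * t * (n div 16) = (\<Sum>u\<in>X. n div 16)" using X by simp
  also have "\<dots> \<le> (\<Sum>u\<in>X. card (N u))"
    by (rule sum_mono) (use X in \<open>auto simp: H_def\<close>)
  also have "\<dots> = (\<Sum>u\<in>X. card {w \<in> {..<n}. w \<in> N u})"
    by (intro sum.cong refl arg_cong[of _ _ card]) (auto simp: N_def)
  also have "\<dots> = (\<Sum>w<n. card {u \<in> X. w \<in> N u})"
    using sum_multicount_gen[of X "{..<n}" "\<lambda>u w. w \<in> N u"] finX by simp
  also have "\<dots> \<le> card W * (32 * t) + n * t"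
  proof -
    have "card {u \<in> X. w \<in> N u} \<le> 32 * t" for w
      using card_mono[OF finX, of "{u \<in> X. w \<in> N u}"] X(2) by auto
    then show ?thesis
      using sum_le_heavy[of "{..<n}" "\<lambda>w. card {u \<in> X. w \<in> N u}" "32 * t" t]
      by (simp only: W_def S_def finite_lessThan card_lessThan)
  qed
  finally have sumW: "32 * t * (n div 16) \<le> card W * (32 * t) + n * t" .
  have large: "t * 2 ^ card X \<le> card W"
  proof (cases "t = 0")
    case False
    have "t * (32 * (n div 16)) \<le> t * (32 * card W + n)"
      using sumW by (simp add: algebra_simps)
    then have "32 * (n div 16) \<le> 32 * card W + n"
      using False by simp
    then have "n \<le> 32 * card W + 32" by linarith
    then show ?thesis using 1 unfolding X(2) by linarith
  qed auto
  obtain Y Z where YZ: "Y \<subseteq> X" "card Y = t" "Z \<subseteq> W" "card Z = t" "\<And>z. z \<in> Z \<Longrightarrow> Y \<subseteq> S z"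
    by (rule common_subset_pigeonhole[OF finX _ _ _ large, where S = S])
      (auto simp: W_def S_def)
  then have "\<forall>x\<in>Y. \<forall>y\<in>Z. x \<noteq> y \<and> \<alpha> {x, y} = c" by (fastforce simp: S_def N_def)
  moreover have "Y \<subseteq> {..<n}" "Z \<subseteq> {..<n}" using YZ Xn by (auto simp: W_def)
  ultimately show ?case using YZ by blast
qed

section \<open>Unavoidable pairs of monochromatic cliques\<close>

definition colored_clique :: "('a set \<Rightarrow> color) \<Rightarrow> color \<Rightarrow> 'a set \<Rightarrow> bool" where
  "colored_clique \<alpha> c S \<longleftrightarrow> (\<forall>x\<in>S. \<forall>y\<in>S. x \<noteq> y \<longrightarrow> \<alpha> {x, y} = c)"

lemma colored_clique_subset: "colored_clique \<alpha> c S \<Longrightarrow> T \<subseteq> S \<Longrightarrow> colored_clique \<alpha> c T"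
  by (auto simp: colored_clique_def)

definition two_part_pattern ::
  "('a set \<Rightarrow> color) \<Rightarrow> color \<Rightarrow> color \<Rightarrow> color \<Rightarrow> 'a set \<Rightarrow> 'a set \<Rightarrow> bool" where
  "two_part_pattern \<alpha> c1 c2 c3 P Q \<longleftrightarrow> P \<inter> Q = {} \<and> colored_clique \<alpha> c1 P \<and>
     colored_clique \<alpha> c2 Q \<and> (\<forall>x\<in>P. \<forall>y\<in>Q. \<alpha> {x, y} = c3)"

lemma two_part_pattern_subset:
  "two_part_pattern \<alpha> c1 c2 c3 P Q \<Longrightarrow> P' \<subseteq> P \<Longrightarrow> Q' \<subseteq> Q \<Longrightarrow>
   two_part_pattern \<alpha> c1 c2 c3 P' Q'"
  unfolding two_part_pattern_def colored_clique_def by blast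

text \<open>For each color \<open>c\<close>, Ramsey inside both sides of a \<open>c\<close>-colored
  biclique gives a pattern with cut color \<open>c\<close>. If it is not the desired one, all its
  colors are \<open>c\<close>, so it supplies a large clique of color \<open>c\<close>. A red and a
  blue clique obtained this way yield the pattern through \<open>bipartite_ramsey\<close>.\<close>

lemma unavoidable_pattern:
  "\<exists>n0. \<forall>n\<ge>n0. \<forall>\<alpha>. (\<forall>c. (n choose 2) div 2 \<le> card (color_class n \<alpha> c)) \<longrightarrow>
     (\<exists>P Q c1 c2 c3. P \<subseteq> {..<n} \<and> Q \<subseteq> {..<n} \<and> card P = t \<and> card Q = t \<and>
        two_part_pattern \<alpha> c1 c2 c3 P Q \<and> \<not> (c1 = c2 \<and> c2 = c3))"
proof -
  obtain r where "r \<ge> t" and r: "\<forall>(A::nat set) B (\<alpha>::nat set \<Rightarrow> color).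
      finite A \<and> finite B \<and> r \<le> card A \<and> r \<le> card B \<longrightarrow>
      (\<exists>c A' B'. A' \<subseteq> A \<and> B' \<subseteq> B \<and> card A' = t \<and> card B' = t \<and> (\<forall>x\<in>A'. \<forall>y\<in>B'. \<alpha> {x, y} = c))"
    using bipartite_ramsey[of t, where 'a = nat] by (elim exE conjE)
  \<comment> \<open>Cliques of size \<open>Suc r\<close> rather than \<open>r\<close>: one vertex
    may be lost when the red and the blue clique are made disjoint.\<close>
  obtain N where N: "\<And>(V::nat set) (\<alpha>::nat set \<Rightarrow> color). \<lbrakk>finite V; N \<le> card V\<rbrakk> \<Longrightarrow>
      \<exists>c S. S \<subseteq> V \<and> card S = Suc r \<and> colored_clique \<alpha> c S"
    using ramsey_monochromatic[of "Suc r"] unfolding colored_clique_def by metis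
  obtain n0 where n0: "\<forall>n\<ge>n0. \<forall>\<alpha> c. (n choose 2) div 2 \<le> card (color_class n \<alpha> c) \<longrightarrow>
      (\<exists>P Q. P \<subseteq> {..<n} \<and> Q \<subseteq> {..<n} \<and> card P = N \<and> card Q = N \<and>
        (\<forall>x\<in>P. \<forall>y\<in>Q. x \<noteq> y \<and> \<alpha> {x, y} = c))"
    using dense_color_class_biclique[of N] by (elim exE)
  have "\<exists>P Q c1 c2 c3. P \<subseteq> {..<n} \<and> Q \<subseteq> {..<n} \<and> card P = t \<and> card Q = t \<and>
        two_part_pattern \<alpha> c1 c2 c3 P Q \<and> \<not> (c1 = c2 \<and> c2 = c3)" (is "?pattern")
    if n: "n \<ge> n0" and dense: "\<And>c. (n choose 2) div 2 \<le> card (color_class n \<alpha> c)" for n \<alpha>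
  proof (rule ccontr)
    assume no: "\<not> ?pattern"
    have clique: "\<exists>S. S \<subseteq> {..<n} \<and> card S = Suc r \<and> colored_clique \<alpha> c S" for c
    proof -
      obtain P Q where PQ: "P \<subseteq> {..<n}" "Q \<subseteq> {..<n}" "card P = N" "card Q = N"
        and across: "\<forall>x\<in>P. \<forall>y\<in>Q. x \<noteq> y \<and> \<alpha> {x, y} = c"
        using n0[rule_format, OF n dense[of c]] by (elim exE conjE)
      obtain c1 S where S: "S \<subseteq> P" "card S = Suc r" "colored_clique \<alpha> c1 S"
        using N[of P \<alpha>] PQ(3) finite_subset[OF PQ(1)] by auto
      obtain c2 T where T: "T \<subseteq> Q" "card T = Suc r" "colored_clique \<alpha> c2 T"
        using N[of Q \<alpha>] PQ(4) finite_subset[OF PQ(2)] by auto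
      have pat: "two_part_pattern \<alpha> c1 c2 c S T"
        using S T across unfolding two_part_pattern_def by blast
      have t: "t \<le> card S" "t \<le> card T" using S T \<open>r \<ge> t\<close> by simp_all
      obtain S' where S': "S' \<subseteq> S" "card S' = t" using obtain_subset_with_card_n[OF t(1)] .
      obtain T' where T': "T' \<subseteq> T" "card T' = t" using obtain_subset_with_card_n[OF t(2)] .
      have "S' \<subseteq> {..<n}" "T' \<subseteq> {..<n}" using S(1) S'(1) T(1) T'(1) PQ(1,2) by auto
      moreover have "two_part_pattern \<alpha> c1 c2 c S' T'"
        by (rule two_part_pattern_subset[OF pat]) fact+
      ultimately have "c1 = c2 \<and> c2 = c"
        using no S'(2) T'(2) by blast
      then show ?thesis using S PQ by blast
    qed
    obtain A where A: "A \<subseteq> {..<n}" "card A = Suc r" "colored_clique \<alpha> Red A"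
      using clique by blast
    obtain B where B: "B \<subseteq> {..<n}" "card B = Suc r" "colored_clique \<alpha> Blue B"
      using clique by blast
    \<comment> \<open>Two common vertices would span an edge that is both red and blue.\<close>
    have "x = y" if "x \<in> A \<inter> B" "y \<in> A \<inter> B" for x y
      using that A(3) B(3) unfolding colored_clique_def by (metis Int_iff color.distinct(1))
    then have "card (A \<inter> B) \<le> 1"
      using card_le_Suc0_iff_eq[of "A \<inter> B"] finite_subset[OF A(1)] by auto
    then have "r \<le> card (A - B)"
      using A(2) card_Diff_subset_Int[of A B] finite_subset[OF A(1)] by auto
    then obtain c A' B' where AB: "A' \<subseteq> A - B" "B' \<subseteq> B" "card A' = t" "card B' = t"
      and across: "\<forall>x\<in>A'. \<forall>y\<in>B'. \<alpha> {x, y} = c"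
      using r[rule_format, of "A - B" B \<alpha>] A B finite_subset[OF A(1)] finite_subset[OF B(1)] by auto
    have "A' \<inter> B' = {}" "A' \<subseteq> A" using AB(1,2) by auto
    then have "two_part_pattern \<alpha> Red Blue c A' B'"
      using colored_clique_subset[OF A(3)] colored_clique_subset[OF B(3) AB(2)] across
      unfolding two_part_pattern_def by simp
    moreover have "A' \<subseteq> {..<n}" "B' \<subseteq> {..<n}" using \<open>A' \<subseteq> A\<close> AB(2) A(1) B(1) by auto
    ultimately show False using no AB(3,4) by blast
  qed
  then show ?thesis by blast
qed

section \<open>Balanceability via half-induced subgraphs and half cuts\<close>

lemma inj_on_image_edges:
  assumes "simple_graph G" "inj_on f (verts G)"
  shows "inj_on ((`) f) (edges G)"
proof (rule inj_on_image)
  show "inj_on f (\<Union> (edges G))"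
    using assms by (auto simp: simple_graph_def intro: inj_on_subset)
qed

lemma finite_edges: "simple_graph G \<Longrightarrow> finite (edges G)"
  unfolding simple_graph_def by (auto intro: finite_subset[of _ "Pow (verts G)"])

text \<open>Half of the edges in one color leaves half for the other, so counting a single, freely
  chosen color \<open>c\<close> suffices.\<close>

lemma contains_balanced_copyI:
  assumes G: "simple_graph G" and f: "inj_on f (verts G)" "f ` verts G \<subseteq> {..<n}"
    and half: "2 * card {e \<in> edges G. \<alpha> (f ` e) = c} = card (edges G)"
  shows "contains_balanced_copy n \<alpha> G"
proof -
  let ?H = "\<lparr>verts = f ` verts G, edges = (`) f ` edges G\<rparr>"
  define E where "E c = {e \<in> (`) f ` edges G. \<alpha> e = c}" for c
  have edge: "e \<subseteq> verts G" "card e = 2" if "e \<in> edges G" for e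
    using that G by (auto simp: simple_graph_def)
  have H: "simple_graph ?H"
    using G f edge unfolding simple_graph_def
    by (auto simp: card_image inj_on_subset[OF f(1)] image_mono)
  then have sub: "subgraph ?H (complete_graph n)"
    using f(2) edge by (fastforce simp: subgraph_def complete_graph_def simple_graph_def)
  have "{u, v} \<in> edges G \<longleftrightarrow> {f u, f v} \<in> (`) f ` edges G" if "u \<in> verts G" "v \<in> verts G" for u v
  proof
    assume "{f u, f v} \<in> (`) f ` edges G"
    then obtain e where "e \<in> edges G" "f ` e = f ` {u, v}" by auto
    then have "e = {u, v}"
      using inj_on_image_eq_iff[OF f(1), of e "{u, v}"] edge(1) that by auto
    then show "{u, v} \<in> edges G" using \<open>e \<in> edges G\<close> by simp
  qed (force intro: image_eqI[of _ _ "{u, v}"])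
  then have iso: "isomorphic G ?H"
    unfolding isomorphic_def using f(1) by (auto simp: bij_betw_def intro!: exI[of _ f])
  have cardE: "card (E c) = card {e \<in> edges G. \<alpha> (f ` e) = c}" for c
  proof -
    have "E c = (`) f ` {e \<in> edges G. \<alpha> (f ` e) = c}" by (auto simp: E_def)
    then show ?thesis
      using card_image[OF inj_on_subset[OF inj_on_image_edges[OF G f(1)]]] by auto
  qed
  have un: "(`) f ` edges G = E Red \<union> E Blue" and dis: "E Red \<inter> E Blue = {}"
    using color.exhaust by (auto simp: E_def)
  have "card (edges G) = card (E Red) + card (E Blue)"
    using card_image[OF inj_on_image_edges[OF G f(1)]] un dis finite_edges[OF G]
    by (metis card_Un_disjoint finite_Un finite_imageI)
  then have "card (E Red) = card (E Blue)"
    using half cardE by (cases c) auto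
  moreover have "\<forall>e\<in>E Red. \<alpha> e = Red" "\<forall>e\<in>E Blue. \<alpha> e = Blue" by (simp_all add: E_def)
  ultimately show ?thesis
    unfolding contains_balanced_copy_def
    by (intro exI[of _ ?H] exI[of _ "E Red"] exI[of _ "E Blue"] conjI sub iso dis) (simp_all add: un)
qed

lemma contains_balanced_copyE:
  assumes "contains_balanced_copy n \<alpha> G" and G: "simple_graph G" and even: "even (card (edges G))"
  obtains f where "inj_on f (verts G)" "f ` verts G \<subseteq> {..<n}"
    "2 * card {e \<in> edges G. \<alpha> (f ` e) = Red} = card (edges G)"
proof -
  obtain H E1 E2 where H: "subgraph H (complete_graph n)" "isomorphic G H"
    and E: "edges H = E1 \<union> E2" "E1 \<inter> E2 = {}" "\<forall>e\<in>E1. \<alpha> e = Red" "\<forall>e\<in>E2. \<alpha> e = Blue"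
    and bal: "\<bar>int (card E1) - int (card E2)\<bar> \<le> 1"
    using assms(1) unfolding contains_balanced_copy_def by blast
  obtain f where f: "bij_betw f (verts G) (verts H)"
    and adj: "\<And>u v. \<lbrakk>u \<in> verts G; v \<in> verts G\<rbrakk> \<Longrightarrow> {u, v} \<in> edges G \<longleftrightarrow> {f u, f v} \<in> edges H"
    using H(2) unfolding isomorphic_def by blast
  have inj: "inj_on f (verts G)" and im: "f ` verts G = verts H"
    using f by (auto simp: bij_betw_def)
  have "simple_graph H" using H(1) by (simp add: subgraph_def)
  have edgesH: "edges H = (`) f ` edges G"
  proof (intro set_eqI iffI)
    fix e assume e: "e \<in> edges H"
    then obtain x y where xy: "e = {x, y}" "x \<in> verts H" "y \<in> verts H"
      using \<open>simple_graph H\<close> by (auto simp: simple_graph_def card_2_iff)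
    then obtain u v where "u \<in> verts G" "v \<in> verts G" "x = f u" "y = f v" using im by blast
    then show "e \<in> (`) f ` edges G"
      using adj[of u v] e xy by (auto intro!: image_eqI[of _ _ "{u, v}"])
  next
    fix e assume "e \<in> (`) f ` edges G"
    then obtain d where d: "d \<in> edges G" "e = f ` d" by blast
    then obtain u v where uv: "d = {u, v}" "u \<in> verts G" "v \<in> verts G"
      using G by (auto simp: simple_graph_def card_2_iff)
    then show "e \<in> edges H" using adj[of u v] d by auto
  qed
  have injE: "inj_on ((`) f) (edges G)" by (rule inj_on_image_edges[OF G inj])
  have fin: "finite E1" "finite E2"
    using finite_edges[OF \<open>simple_graph H\<close>] E(1) by auto
  have "E1 = {e \<in> edges H. \<alpha> e = Red}"
    using E by auto
  also have "\<dots> = (`) f ` {e \<in> edges G. \<alpha> (f ` e) = Red}"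
    unfolding edgesH by auto
  finally have E1: "E1 = (`) f ` {e \<in> edges G. \<alpha> (f ` e) = Red}" .
  have "card E1 = card {e \<in> edges G. \<alpha> (f ` e) = Red}"
    unfolding E1 by (rule card_image[OF inj_on_subset[OF injE]]) auto
  moreover have "card E1 + card E2 = card (edges G)"
    using card_Un_disjoint[OF fin E(2)] card_image[OF injE] edgesH E(1) by simp
  \<comment> \<open>The difference has the parity of the even total, so a difference of at most 1 is
    0.\<close>
  moreover have "card E1 = card E2"
    using bal even \<open>card E1 + card E2 = card (edges G)\<close> by presburger
  moreover have "f ` verts G \<subseteq> {..<n}"
    using im H(1) by (simp add: subgraph_def complete_graph_def)
  ultimately show ?thesis using that[of f] inj by linarith
qed

text \<open>Each part is as large as all of \<open>V\<close>, so the split by \<open>S\<close> may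
  be arbitrarily uneven.\<close>

lemma inj_into_two_parts:
  assumes "finite V" "card P = card V" "card Q = card V" "finite P" "finite Q" "P \<inter> Q = {}"
  obtains f where "inj_on f V" "\<And>v. v \<in> V \<Longrightarrow> if v \<in> S then f v \<in> P else f v \<in> Q"
proof -
  obtain g where g: "g ` V \<subseteq> P" "inj_on g V" using card_le_inj[of V P] assms by auto
  obtain h where h: "h ` V \<subseteq> Q" "inj_on h V" using card_le_inj[of V Q] assms by auto
  let ?f = "\<lambda>v. if v \<in> S then g v else h v"
  have "inj_on ?f V"
  proof (rule inj_onI)
    fix u v assume uv: "u \<in> V" "v \<in> V" "?f u = ?f v"
    then have "g u \<noteq> h v" "h u \<noteq> g v" using g(1) h(1) assms(6) by (auto simp: disjoint_iff)
    then show "u = v" using uv g(2) h(2) by (auto simp: inj_on_def split: if_splits)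
  qed
  moreover have "if v \<in> S then ?f v \<in> P else ?f v \<in> Q" if "v \<in> V" for v
    using that g(1) h(1) by auto
  ultimately show ?thesis using that by blast
qed

text \<open>With two colors, exactly one of \<open>c1\<close>, \<open>c2\<close>, \<open>c3\<close>
  differs from the other two. If it is the cut color \<open>c3\<close>, mapping \<open>X\<close>
  into \<open>P\<close> and the rest into \<open>Q\<close> gives it to the edges of the half cut. If
  it is the color of one clique, mapping \<open>W\<close> into that clique gives it to the edges
  induced by \<open>W\<close>.\<close>

lemma balanceable_if_half_induced_and_half_cut:
  assumes G: "simple_graph G"
    and W: "2 * card {e \<in> edges G. e \<subseteq> W} = card (edges G)"
    and X: "2 * card {e \<in> edges G. \<not> e \<subseteq> X \<and> e \<inter> X \<noteq> {}} = card (edges G)"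
  shows "balanceable G"
proof -
  obtain n0 where n0: "\<forall>n\<ge>n0. \<forall>\<alpha>. (\<forall>c. (n choose 2) div 2 \<le> card (color_class n \<alpha> c)) \<longrightarrow>
     (\<exists>P Q c1 c2 c3. P \<subseteq> {..<n} \<and> Q \<subseteq> {..<n} \<and> card P = card (verts G) \<and> card Q = card (verts G) \<and>
        two_part_pattern \<alpha> c1 c2 c3 P Q \<and> \<not> (c1 = c2 \<and> c2 = c3))"
    using unavoidable_pattern[of "card (verts G)"] by (elim exE)
  have copy: "contains_balanced_copy n \<alpha> G"
    if n: "n \<ge> n0" and dense: "\<And>c. (n choose 2) div 2 \<le> card (color_class n \<alpha> c)" for n \<alpha>
  proof -
    obtain P Q c1 c2 c3 where PQ: "P \<subseteq> {..<n}" "Q \<subseteq> {..<n}"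
        "card P = card (verts G)" "card Q = card (verts G)"
      and pat: "two_part_pattern \<alpha> c1 c2 c3 P Q" and ne: "\<not> (c1 = c2 \<and> c2 = c3)"
      using n0[rule_format, OF n dense] by (elim exE conjE)
    have copyI: "contains_balanced_copy n \<alpha> G"
      if half: "2 * card {e \<in> edges G. (if e \<subseteq> S then c1 else if e \<inter> S = {} then c2 else c3) = c}
        = card (edges G)" for S c
    proof -
      obtain f where f: "inj_on f (verts G)"
        and fPQ: "\<And>v. v \<in> verts G \<Longrightarrow> if v \<in> S then f v \<in> P else f v \<in> Q"
        using inj_into_two_parts[of "verts G" P Q S] PQ pat G
          finite_subset[OF PQ(1)] finite_subset[OF PQ(2)]
        by (metis finite_lessThan simple_graph_def two_part_pattern_def)
      have "\<alpha> (f ` e) = (if e \<subseteq> S then c1 else if e \<inter> S = {} then c2 else c3)"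
        if "e \<in> edges G" for e
      proof -
        obtain u v where uv: "e = {u, v}" "u \<in> verts G" "v \<in> verts G" "u \<noteq> v"
          using G \<open>e \<in> edges G\<close> by (auto simp: simple_graph_def card_2_iff)
        then have "f u \<noteq> f v" using f by (auto simp: inj_on_def)
        then show ?thesis
          using fPQ[OF uv(2)] fPQ[OF uv(3)] pat uv
          by (auto simp: two_part_pattern_def colored_clique_def insert_commute split: if_splits)
      qed
      then have "{e \<in> edges G. \<alpha> (f ` e) = c} =
          {e \<in> edges G. (if e \<subseteq> S then c1 else if e \<inter> S = {} then c2 else c3) = c}"
        by auto
      moreover have "f ` verts G \<subseteq> {..<n}" using fPQ PQ(1,2) by (fastforce split: if_splits)
      ultimately show ?thesis
        using contains_balanced_copyI[OF G f, of n \<alpha> c] half by simp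
    qed
    \<comment> \<open>An empty edge would lie inside both \<open>W\<close> and its complement, which
      would break the third case below.\<close>
    have ne_empty: "e \<noteq> {}" if "e \<in> edges G" for e
      using G that by (auto simp: simple_graph_def)
    consider "c1 = c2" "c3 \<noteq> c1" | "c2 = c3" "c1 \<noteq> c2" | "c1 = c3" "c1 \<noteq> c2"
      using ne by (metis color.exhaust)
    then show ?thesis
    proof cases
      case 1
      then have "{e \<in> edges G. (if e \<subseteq> X then c1 else if e \<inter> X = {} then c2 else c3) = c3}
        = {e \<in> edges G. \<not> e \<subseteq> X \<and> e \<inter> X \<noteq> {}}"
        by auto
      then show ?thesis using copyI[of X c3] X by simp
    next
      case 2
      then have "{e \<in> edges G. (if e \<subseteq> W then c1 else if e \<inter> W = {} then c2 else c3) = c1}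
        = {e \<in> edges G. e \<subseteq> W}"
        by auto
      then show ?thesis using copyI[of W c1] W by simp
    next
      case 3
      then have "{e \<in> edges G. (if e \<subseteq> - W then c1 else if e \<inter> - W = {} then c2 else c3) = c2}
        = {e \<in> edges G. e \<subseteq> W}"
        using ne_empty by auto
      then show ?thesis using copyI[of "- W" c2] W by simp
    qed
  qed
  \<comment> \<open>The witness is the largest admissible \<open>m\<close>, so exceeding it means
    having at least \<open>(n choose 2) div 2\<close> edges. The bound \<open>n \<ge> 3\<close>
    keeps the subtraction of 1 from truncating.\<close>
  have "\<exists>m. m < (n choose 2) div 2 \<and>
      (\<forall>\<alpha>. card (color_class n \<alpha> Red) > m \<and> card (color_class n \<alpha> Blue) > m
         \<longrightarrow> contains_balanced_copy n \<alpha> G)" if "n \<ge> max n0 3" for n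
  proof -
    have "3 * 2 \<le> n * (n - 1)" using that by (intro mult_le_mono) auto
    then have pos: "(n choose 2) div 2 > 0" by (simp add: choose_two)
    have "(n choose 2) div 2 \<le> card (color_class n \<alpha> c)"
      if "card (color_class n \<alpha> Red) > (n choose 2) div 2 - 1"
        "card (color_class n \<alpha> Blue) > (n choose 2) div 2 - 1" for \<alpha> c
      using that by (cases c) auto
    then show ?thesis
      using copy pos that by (intro exI[of _ "(n choose 2) div 2 - 1"]) auto
  qed
  then show ?thesis unfolding balanceable_def by blast
qed

section \<open>Necessity of a half cut\<close>

definition cut_coloring :: "nat \<Rightarrow> nat set \<Rightarrow> color" where
  "cut_coloring k e = (if \<not> e \<subseteq> {..<k} \<and> e \<inter> {..<k} \<noteq> {} then Red else Blue)"

lemma card_cut_coloring_Red: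
  assumes "k \<le> n"
  shows "card (color_class n (cut_coloring k) Red) = k * (n - k)"
proof -
  have "color_class n (cut_coloring k) Red = (\<lambda>(x, y). {x, y}) ` ({..<k} \<times> {k..<n})"
  proof (intro set_eqI iffI)
    fix e assume "e \<in> color_class n (cut_coloring k) Red"
    then obtain x y where e: "e = {x, y}" "x < n" "y < n" "\<not> {x, y} \<subseteq> {..<k}" "{x, y} \<inter> {..<k} \<noteq> {}"
      by (auto simp: color_class_def complete_graph_def cut_coloring_def card_2_iff split: if_splits)
    then have "(x, y) \<in> {..<k} \<times> {k..<n} \<or> (y, x) \<in> {..<k} \<times> {k..<n}" by auto
    moreover have "e = {y, x}" using e(1) by (simp add: insert_commute)
    ultimately show "e \<in> (\<lambda>(x, y). {x, y}) ` ({..<k} \<times> {k..<n})"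
      using e(1) by (metis (no_types, lifting) case_prod_conv image_eqI)
  next
    fix e assume "e \<in> (\<lambda>(x, y). {x, y}) ` ({..<k} \<times> {k..<n})"
    then show "e \<in> color_class n (cut_coloring k) Red"
      using assms by (auto simp: color_class_def complete_graph_def cut_coloring_def)
  qed
  moreover have "inj_on (\<lambda>(x, y). {x, y}) ({..<k} \<times> {k..<n})"
    by (auto simp: inj_on_def doubleton_eq_iff)
  ultimately show ?thesis by (simp add: card_image)
qed

lemma card_color_classes:
  "card (color_class n \<alpha> Red) + card (color_class n \<alpha> Blue) = n choose 2"
proof -
  have "edges (complete_graph n) = color_class n \<alpha> Red \<union> color_class n \<alpha> Blue"
    using color.exhaust by (auto simp: color_class_def)
  moreover have "color_class n \<alpha> Red \<inter> color_class n \<alpha> Blue = {}"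
    by (auto simp: color_class_def)
  moreover have "finite (edges (complete_graph n))"
    by (rule finite_edges[OF simple_graph_complete_graph])
  ultimately have "card (color_class n \<alpha> Red) + card (color_class n \<alpha> Blue)
      = card (edges (complete_graph n))"
    by (metis card_Un_disjoint finite_Un)
  then show ?thesis by (simp add: complete_graph_def n_subsets)
qed

text \<open>For a square \<open>n = s\<^sup>2\<close> the cut between the first \<open>(s\<^sup>2 - s) / 2\<close> vertices and the other
  \<open>(s\<^sup>2 + s) / 2\<close> ones consists of exactly half of the edges of the complete graph.\<close>

lemma exists_balanced_cut:
  fixes s :: nat
  shows "\<exists>k \<le> s * s. 2 * (k * (s * s - k)) = (s * s) choose 2"
proof -
  have "even (s * s - s)" by (cases s) auto
  then obtain k where k: "s * s - s = 2 * k" by blast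
  have ss: "s * s = 2 * k + s" using k le_square[of s] by linarith
  have "4 * (k * (k + s)) = (2 * k) * (2 * k + 2 * s)" by (simp add: algebra_simps)
  also have "\<dots> = (2 * k) * (s * s + s)" using ss by simp
  also have "\<dots> = (s * s - s) * (s * s + s)" using k by simp
  also have "\<dots> = s * s * (s * s - 1)"
    by (cases s) (auto simp: algebra_simps)
  finally have "4 * (k * (k + s)) = s * s * (s * s - 1)" .
  then have "2 * (k * (k + s)) = (s * s) choose 2"
    unfolding choose_two by simp
  moreover have "s * s - k = k + s" "k \<le> s * s" using ss by linarith+
  ultimately show ?thesis by metis
qed

text \<open>Color a half cut of a complete graph red and the rest blue. Both classes then exceed
  every admissible \<open>m\<close>, and a balanced copy of \<open>G\<close> pulls the red cut back
  to a half cut of \<open>G\<close>.\<close>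

lemma not_balanceable_if_no_half_cut:
  assumes G: "simple_graph G" "even (card (edges G))"
    and no: "\<And>X. 2 * card {e \<in> edges G. \<not> e \<subseteq> X \<and> e \<inter> X \<noteq> {}} \<noteq> card (edges G)"
  shows "\<not> balanceable G"
proof
  assume "balanceable G"
  then obtain n0 where n0: "\<forall>n\<ge>n0. \<exists>m. m < (n choose 2) div 2 \<and>
      (\<forall>\<alpha>. card (color_class n \<alpha> Red) > m \<and> card (color_class n \<alpha> Blue) > m
         \<longrightarrow> contains_balanced_copy n \<alpha> G)"
    unfolding balanceable_def by blast
  \<comment> \<open>A square, as \<open>exists_balanced_cut\<close> demands, and at least
    \<open>n0\<close>.\<close>
  define n where "n = n0 * n0"
  obtain k where k: "k \<le> n" "2 * (k * (n - k)) = n choose 2"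
    using exists_balanced_cut[of n0] unfolding n_def by blast
  have "n0 \<le> n" unfolding n_def by (rule le_square)
  then obtain m where m: "m < (n choose 2) div 2"
    and copy: "\<forall>\<alpha>. card (color_class n \<alpha> Red) > m \<and> card (color_class n \<alpha> Blue) > m
      \<longrightarrow> contains_balanced_copy n \<alpha> G"
    using n0 by blast
  have "card (color_class n (cut_coloring k) Red) = (n choose 2) div 2"
    using card_cut_coloring_Red[OF k(1)] k(2) by linarith
  moreover have "card (color_class n (cut_coloring k) Blue) = (n choose 2) div 2"
    using card_cut_coloring_Red[OF k(1)] card_color_classes[of n "cut_coloring k"] k(2) by linarith
  ultimately have "contains_balanced_copy n (cut_coloring k) G" using copy m by simp
  then obtain f where f: "2 * card {e \<in> edges G. cut_coloring k (f ` e) = Red} = card (edges G)"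
    using contains_balanced_copyE[OF _ G] by blast
  have "{e \<in> edges G. cut_coloring k (f ` e) = Red}
      = {e \<in> edges G. \<not> e \<subseteq> f -` {..<k} \<and> e \<inter> f -` {..<k} \<noteq> {}}"
    by (auto simp: cut_coloring_def split: if_splits)
  then show False using f no[of "f -` {..<k}"] by simp
qed

section \<open>The triangular grid\<close>

text \<open>Indexed by the apex \<open>(i, j)\<close>. A horizontal edge belongs to the triangle
  whose apex is one row higher, so in the grid the apexes range over the rows \<open>1\<close> to
  \<open>h - 1\<close>.\<close>

definition up_triangle :: "nat \<Rightarrow> nat \<Rightarrow> (nat \<times> nat) set set" where
  "up_triangle i j =
     {{(i, j), (i, j + 1)}, {(i, j), (i + 1, j + 1)}, {(i, j + 1), (i + 1, j + 1)}}"

lemma edges_triangular_grid: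
  "edges (triangular_grid h) = (\<Union>j\<in>{1..<h}. \<Union>i\<in>{1..j}. up_triangle i j)"
proof (intro set_eqI iffI)
  fix e assume "e \<in> edges (triangular_grid h)"
  then consider i j where "e = {(i, j), (i + 1, j)}" "1 \<le> i" "i < j" "j \<le> h"
    | i j where "e = {(i, j), (i, j + 1)} \<or> e = {(i, j), (i + 1, j + 1)}" "1 \<le> i" "i \<le> j" "j < h"
    by (auto simp: triangular_grid_def)
  then show "e \<in> (\<Union>j\<in>{1..<h}. \<Union>i\<in>{1..j}. up_triangle i j)"
  proof cases
    case (1 i j)
    then have "j - 1 \<in> {1..<h}" "i \<in> {1..j - 1}" "e \<in> up_triangle i (j - 1)"
      by (auto simp: up_triangle_def)
    then show ?thesis by blast
  next
    case (2 i j)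
    then have "j \<in> {1..<h}" "i \<in> {1..j}" "e \<in> up_triangle i j"
      by (auto simp: up_triangle_def)
    then show ?thesis by blast
  qed
next
  fix e assume "e \<in> (\<Union>j\<in>{1..<h}. \<Union>i\<in>{1..j}. up_triangle i j)"
  then obtain i j where ij: "1 \<le> i" "i \<le> j" "j < h" and "e \<in> up_triangle i j" by auto
  then consider "e = {(i, j), (i, j + 1)}" | "e = {(i, j), (i + 1, j + 1)}"
    | "e = {(i, j + 1), (i + 1, j + 1)}"
    by (auto simp: up_triangle_def)
  then show "e \<in> edges (triangular_grid h)"
    unfolding triangular_grid_def ugraph.simps
  proof cases
    case 3
    then have "1 \<le> i \<and> i < j + 1 \<and> j + 1 \<le> h" using ij by simp
    with 3 show "e \<in> {{(i, j), (i + 1, j)} |i j. 1 \<le> i \<and> i < j \<and> j \<le> h}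
      \<union> {{(i, j), (i, j + 1)} |i j. 1 \<le> i \<and> i \<le> j \<and> j < h}
      \<union> {{(i, j), (i + 1, j + 1)} |i j. 1 \<le> i \<and> i \<le> j \<and> j < h}" by blast
  qed (use ij in blast)+
qed

lemma up_triangle_disjoint:
  "(i, j) \<noteq> (i', j') \<Longrightarrow> up_triangle i j \<inter> up_triangle i' j' = {}"
  by (auto simp: up_triangle_def doubleton_eq_iff)

text \<open>The triangles are pairwise edge-disjoint. All edge counts below, of the whole grid, of
  cuts and of induced subgraphs, are reduced to counts in single triangles by this sum.\<close>

lemma card_grid_edges_filter:
  "card {e \<in> edges (triangular_grid h). P e} =
     (\<Sum>j=1..<h. \<Sum>i=1..j. card {e \<in> up_triangle i j. P e})"
proof -
  let ?T = "\<lambda>i j. {e \<in> up_triangle i j. P e}"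
  have fin: "finite (?T i j)" for i j by (simp add: up_triangle_def)
  have dis: "?T i j \<inter> ?T i' j' = {}" if "(i, j) \<noteq> (i', j')" for i j i' j'
    using up_triangle_disjoint[OF that] by auto
  have "{e \<in> edges (triangular_grid h). P e} = (\<Union>j\<in>{1..<h}. \<Union>i\<in>{1..j}. ?T i j)"
    unfolding edges_triangular_grid by auto
  also have "card \<dots> = (\<Sum>j=1..<h. card (\<Union>i\<in>{1..j}. ?T i j))"
  proof (rule card_UN_disjoint)
    show "\<forall>j\<in>{1..<h}. \<forall>j'\<in>{1..<h}. j \<noteq> j' \<longrightarrow>
        (\<Union>i\<in>{1..j}. ?T i j) \<inter> (\<Union>i\<in>{1..j'}. ?T i j') = {}"
      using up_triangle_disjoint by blast
  qed (use fin in auto)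
  also have "\<dots> = (\<Sum>j=1..<h. \<Sum>i=1..j. card (?T i j))"
  proof (rule sum.cong[OF refl], rule card_UN_disjoint)
    show "\<forall>i\<in>{1..j}. \<forall>i'\<in>{1..j}. i \<noteq> i' \<longrightarrow> ?T i j \<inter> ?T i' j = {}" for j
      using up_triangle_disjoint by blast
  qed (use fin in auto)
  finally show ?thesis .
qed

lemma card_up_triangle_filter:
  "card {e \<in> up_triangle i j. P e} =
     of_bool (P {(i, j), (i, j + 1)}) + of_bool (P {(i, j), (i + 1, j + 1)})
     + of_bool (P {(i, j + 1), (i + 1, j + 1)})"
proof -
  have "{e \<in> up_triangle i j. P e} =
      (if P {(i, j), (i, j + 1)} then {{(i, j), (i, j + 1)}} else {})
      \<union> (if P {(i, j), (i + 1, j + 1)} then {{(i, j), (i + 1, j + 1)}} else {})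
      \<union> (if P {(i, j + 1), (i + 1, j + 1)} then {{(i, j + 1), (i + 1, j + 1)}} else {})"
    by (auto simp: up_triangle_def)
  then show ?thesis
    by (auto simp: doubleton_eq_iff)
qed

lemma sum_triangular: "2 * (\<Sum>j=1..<h. j) = h * (h - 1)" for h :: nat
proof (induction h)
  case (Suc h)
  then show ?case by (cases h) (auto simp: algebra_simps)
qed simp

lemma card_edges_triangular_grid: "2 * card (edges (triangular_grid h)) = 3 * (h * (h - 1))"
proof -
  have "card (edges (triangular_grid h)) = (\<Sum>j=1..<h. \<Sum>i=1..j. 1 + 1 + 1)"
    using card_grid_edges_filter[of h "\<lambda>_. True"] unfolding card_up_triangle_filter by simp
  also have "\<dots> = 3 * (\<Sum>j=1..<h. j)"
    unfolding sum_distrib_left by (intro sum.cong) auto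
  finally show ?thesis using sum_triangular[of h] by simp
qed

section \<open>Cuts of the grid\<close>

lemma even_card_grid_cut:
  "even (card {e \<in> edges (triangular_grid h). \<not> e \<subseteq> X \<and> e \<inter> X \<noteq> {}})"
  unfolding card_grid_edges_filter by (intro dvd_sum) (auto simp: card_up_triangle_filter)

text \<open>A triangle with apex in row \<open>j\<close> has its other two vertices in row
  \<open>j + 1\<close>, so it is cut, in exactly two edges, when these rows are separated. There are
  \<open>j\<close> such triangles.\<close>

lemma card_grid_row_cut:
  "card {e \<in> edges (triangular_grid h). \<not> e \<subseteq> {(i, j). j \<in> J} \<and> e \<inter> {(i, j). j \<in> J} \<noteq> {}} =
     2 * \<Sum> {j \<in> {1..<h}. (j \<in> J) \<noteq> (Suc j \<in> J)}"
proof -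
  have "card {e \<in> edges (triangular_grid h). \<not> e \<subseteq> {(i, j). j \<in> J} \<and> e \<inter> {(i, j). j \<in> J} \<noteq> {}}
      = (\<Sum>j=1..<h. \<Sum>i=1..j. if (j \<in> J) \<noteq> (Suc j \<in> J) then 2 else 0)"
    unfolding card_grid_edges_filter by (intro sum.cong refl) (simp add: card_up_triangle_filter)
  also have "\<dots> = (\<Sum>j=1..<h. if (j \<in> J) \<noteq> (Suc j \<in> J) then 2 * j else 0)"
    by (intro sum.cong) auto
  also have "\<dots> = 2 * \<Sum> {j \<in> {1..<h}. (j \<in> J) \<noteq> (Suc j \<in> J)}"
    by (subst sum.inter_filter[symmetric]) (simp_all add: sum_distrib_left)
  finally show ?thesis .
qed

text \<open>Greedy choice: the largest number \<open>h\<close> is taken only when the smaller ones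
  do not suffice.\<close>

lemma exists_subset_sum:
  fixes m :: nat
  assumes "m \<le> (\<Sum>j=1..<h. j)"
  shows "\<exists>S\<subseteq>{1..<h}. \<Sum>S = m"
  using assms
proof (induction h arbitrary: m)
  case (Suc h)
  show ?case
  proof (cases "m \<le> (\<Sum>j=1..<h. j)")
    case True
    then obtain S where "S \<subseteq> {1..<h}" "\<Sum>S = m" using Suc.IH by blast
    then show ?thesis by (intro exI[of _ S]) auto
  next
    case False
    then have "h \<ge> 1" using Suc.prems by (cases h) auto
    \<comment> \<open>Here \<open>m\<close> exceeds a sum that contains \<open>h - 1\<close>, except
      for \<open>h = 1\<close>, where the sum is empty.\<close>
    have "h \<le> m"
    proof (cases "h = 1")
      case False
      with \<open>h \<ge> 1\<close> have "h - 1 \<in> {1..<h}" by auto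
      then have "h - 1 \<le> (\<Sum>j=1..<h. j)" by (intro member_le_sum) auto
      then show ?thesis using \<open>\<not> m \<le> _\<close> by linarith
    qed (use \<open>\<not> m \<le> _\<close> in auto)
    moreover have "m - h \<le> (\<Sum>j=1..<h. j)"
      using Suc.prems \<open>h \<ge> 1\<close> by simp
    ultimately obtain S where S: "S \<subseteq> {1..<h}" "\<Sum>S = m - h" using Suc.IH by blast
    then have "\<Sum>(insert h S) = m"
      using \<open>h \<le> m\<close> finite_subset[OF S(1)] by (subst sum.insert) auto
    then show ?thesis using S \<open>h \<ge> 1\<close> by (intro exI[of _ "insert h S"]) auto
  qed
qed auto

text \<open>Put \<open>j\<close> into \<open>J\<close> when the number of elements of
  \<open>S\<close> below \<open>j\<close> is odd; passing from \<open>j\<close> to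
  \<open>Suc j\<close> flips this parity exactly at the elements of \<open>S\<close>.\<close>

lemma exists_toggling_set:
  fixes S :: "nat set"
  shows "\<exists>J. \<forall>j. (j \<in> J) \<noteq> (Suc j \<in> J) \<longleftrightarrow> j \<in> S"
proof -
  have step: "card (S \<inter> {..<Suc j}) = card (S \<inter> {..<j}) + of_bool (j \<in> S)" for j
    by (auto simp: lessThan_Suc)
  have "odd (card (S \<inter> {..<j})) \<noteq> odd (card (S \<inter> {..<Suc j})) \<longleftrightarrow> j \<in> S" for j
    by (cases "j \<in> S") (simp_all add: step)
  then show ?thesis by (intro exI[of _ "{j. odd (card (S \<inter> {..<j}))}"]) auto
qed

lemma exists_grid_half_cut:
  assumes "8 dvd h * (h - 1)"
  shows "\<exists>X. 2 * card {e \<in> edges (triangular_grid h). \<not> e \<subseteq> X \<and> e \<inter> X \<noteq> {}}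
    = card (edges (triangular_grid h))"
proof -
  obtain q where q: "h * (h - 1) = 8 * q" using assms by blast
  \<comment> \<open>The grid has \<open>12 * q\<close> edges and a row cut has twice the sum of its
    separated rows \<open>j\<close>, so the target sum is \<open>3 * q\<close>, out of a total of
    \<open>4 * q\<close>.\<close>
  have "3 * q \<le> (\<Sum>j=1..<h. j)" using sum_triangular[of h] q by linarith
  then obtain S where S: "S \<subseteq> {1..<h}" "\<Sum>S = 3 * q" using exists_subset_sum by blast
  obtain J where J: "\<forall>j. (j \<in> J) \<noteq> (Suc j \<in> J) \<longleftrightarrow> j \<in> S"
    using exists_toggling_set by blast
  have "{j \<in> {1..<h}. (j \<in> J) \<noteq> (Suc j \<in> J)} = S" using J S(1) by auto
  then have "card {e \<in> edges (triangular_grid h). \<not> e \<subseteq> {(i, j). j \<in> J} \<and> e \<inter> {(i, j). j \<in> J} \<noteq> {}}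
      = 6 * q"
    unfolding card_grid_row_cut using S(2) by simp
  then show ?thesis using card_edges_triangular_grid[of h] q
    by (intro exI[of _ "{(i, j). j \<in> J}"]) linarith
qed

section \<open>Induced subgraphs of the grid\<close>

definition row_prefix :: "nat \<Rightarrow> nat \<Rightarrow> (nat \<times> nat) set" where
  "row_prefix k s = {(i, j). 3 \<le> j \<and> (j \<le> k \<or> j = Suc k \<and> i \<le> s)}"

text \<open>Count by apex rows: row 1 gives 0, row 2 gives 2, each row \<open>j\<close> from 3 to
  \<open>k - 1\<close> gives \<open>3 * j\<close>, and row \<open>k\<close> gives
  \<open>3 * s - 2\<close>. The 2 and the -2 cancel, which leaves a multiple of 3. The 18 on the
  left avoids natural subtraction.\<close>

lemma card_grid_row_prefix:
  assumes k: "3 \<le> k" "k < h" and s: "1 \<le> s" "s \<le> k"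
  shows "2 * card {e \<in> edges (triangular_grid h). e \<subseteq> row_prefix k s} + 18 = 3 * (k * (k - 1) + 2 * s)"
proof -
  let ?c = "\<lambda>i j. card {e \<in> up_triangle i j. e \<subseteq> row_prefix k s}"
  have "{1..<h} = {1} \<union> {2} \<union> {3..<k} \<union> {k} \<union> {Suc k..<h}" using k by auto
  then have "(\<Sum>j=1..<h. \<Sum>i=1..j. ?c i j) = (\<Sum>i=1..1. ?c i 1) + (\<Sum>i=1..2. ?c i 2) +
      (\<Sum>j=3..<k. \<Sum>i=1..j. ?c i j) + (\<Sum>i=1..k. ?c i k) + (\<Sum>j=Suc k..<h. \<Sum>i=1..j. ?c i j)"
    using k by (simp add: sum.union_disjoint)
  moreover have "(\<Sum>i=1..1. ?c i 1) = 0"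
    using k by (simp add: card_up_triangle_filter row_prefix_def)
  \<comment> \<open>Only the two horizontal edges of row 3 survive.\<close>
  moreover have "(\<Sum>i=1..2. ?c i 2) = 2"
    using k by (simp add: card_up_triangle_filter row_prefix_def numeral_2_eq_2)
  moreover have "(\<Sum>j=3..<k. \<Sum>i=1..j. ?c i j) = (\<Sum>j=3..<k. \<Sum>i=1..j. 3)"
    by (intro sum.cong refl) (simp add: card_up_triangle_filter row_prefix_def)
  moreover have "(\<Sum>i=1..k. ?c i k) = 3 * s - 2"
  proof -
    \<comment> \<open>The edge to \<open>(i, k + 1)\<close> needs \<open>i \<le> s\<close>; the
      other two edges contain \<open>(i + 1, k + 1)\<close> and need
      \<open>i + 1 \<le> s\<close>.\<close>
    have "(\<Sum>i=1..k. ?c i k) = (\<Sum>i=1..k. of_bool (i \<le> s) + 2 * of_bool (i \<le> s - 1))"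
      using k s by (intro sum.cong refl) (auto simp: card_up_triangle_filter row_prefix_def)
    also have "\<dots> = card {i \<in> {1..k}. i \<le> s} + 2 * card {i \<in> {1..k}. i \<le> s - 1}"
      by (simp add: sum.distrib sum_of_bool_eq Int_def flip: sum_distrib_left)
    also have "{i \<in> {1..k}. i \<le> s} = {1..s}" using s by auto
    also have "{i \<in> {1..k}. i \<le> s - 1} = {1..s - 1}" using s by auto
    finally show ?thesis using s by simp
  qed
  moreover have "(\<Sum>j=Suc k..<h. \<Sum>i=1..j. ?c i j) = 0"
    by (simp add: card_up_triangle_filter row_prefix_def)
  moreover have "2 * (\<Sum>j=3..<k. j) + 6 = k * (k - 1)"
  proof -
    have "{1..<k} = {1} \<union> {2} \<union> {3..<k}" using k by auto
    then have "(\<Sum>j=1..<k. j) = 3 + (\<Sum>j=3..<k. j)" by (simp add: sum.union_disjoint)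
    then show ?thesis using sum_triangular[of k] by simp
  qed
  moreover have "(\<Sum>j=3..<k. \<Sum>i=1..j. 3) = 3 * (\<Sum>j=3..<k. j)"
    by (simp add: sum_distrib_left mult.commute)
  ultimately show ?thesis using s unfolding card_grid_edges_filter by simp
qed

text \<open>Halved, this places \<open>M + 3\<close> above one triangular number and at most at the
  next. The induction fills the current row and then opens a new one, starting from one vertex after
  three rows.\<close>

lemma exists_triangular_decomposition:
  fixes M :: nat
  assumes "M \<ge> 1"
  shows "\<exists>k s. 3 \<le> k \<and> 1 \<le> s \<and> s \<le> k \<and> 2 * M + 6 = k * (k - 1) + 2 * s"
  using assms
proof (induction M rule: dec_induct)
  case base
  show ?case by (intro exI[of _ 3] exI[of _ 1]) simp
next
  case (step M)
  then obtain k s where ks: "3 \<le> k" "1 \<le> s" "s \<le> k" "2 * M + 6 = k * (k - 1) + 2 * s" by blast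
  show ?case
  proof (cases "s < k")
    case True
    then show ?thesis using ks by (intro exI[of _ k] exI[of _ "Suc s"]) simp
  next
    case False
    moreover have "Suc k * (Suc k - 1) = k * (k - 1) + 2 * k" using ks(1) by (cases k) auto
    ultimately show ?thesis using ks by (intro exI[of _ "Suc k"] exI[of _ 1]) auto
  qed
qed

lemma exists_grid_half_induced:
  assumes "4 dvd h * (h - 1)"
  shows "\<exists>W. 2 * card {e \<in> edges (triangular_grid h). e \<subseteq> W} = card (edges (triangular_grid h))"
proof (cases "h \<le> 1")
  case True
  then have "edges (triangular_grid h) = {}" by (simp add: edges_triangular_grid)
  then show ?thesis by simp
next
  case False
  \<comment> \<open>The grid has \<open>6 * M\<close> edges, so \<open>3 * M\<close> are wanted; by
    \<open>card_grid_row_prefix\<close> this amounts to the equation of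
    \<open>exists_triangular_decomposition\<close>.\<close>
  obtain M where M: "h * (h - 1) = 4 * M" using assms by blast
  have "h > 3"
  proof (rule ccontr)
    assume "\<not> h > 3"
    then have "h = 2 \<or> h = 3" using False by linarith
    then have "4 * M = 2 \<or> 4 * M = 6" unfolding M[symmetric] by auto
    then show False by presburger
  qed
  then have "4 * 3 \<le> h * (h - 1)" by (intro mult_le_mono) auto
  then have M3: "M \<ge> 3" using M by simp
  obtain k s where ks: "3 \<le> k" "1 \<le> s" "s \<le> k" "2 * M + 6 = k * (k - 1) + 2 * s"
    using exists_triangular_decomposition[of M] M3 by auto
  \<comment> \<open>If \<open>k \<ge> h\<close>, then \<open>2 * M + 6 \<ge> 4 * M + 2\<close>,
    against \<open>M \<ge> 3\<close>.\<close>
  have "k < h"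
  proof (rule ccontr)
    assume "\<not> k < h"
    then have "h * (h - 1) \<le> k * (k - 1)" by (intro mult_le_mono) auto
    then show False using ks(2,4) M M3 by linarith
  qed
  then have "2 * card {e \<in> edges (triangular_grid h). e \<subseteq> row_prefix k s} = 6 * M"
    using card_grid_row_prefix[OF ks(1) \<open>k < h\<close> ks(2,3)] unfolding ks(4)[symmetric] by simp
  then show ?thesis using card_edges_triangular_grid[of h] M
    by (intro exI[of _ "row_prefix k s"]) linarith
qed

theorem theorem21:
  fixes h :: nat
  assumes "h > 0"
    and "h mod 8 \<in> {0, 1, 4, 5}"
  shows "balanceable (triangular_grid h) \<longleftrightarrow> h mod 8 \<in> {0, 1}"
proof
  assume "h mod 8 \<in> {0, 1}"
  then have "h mod 8 = 0 \<or> h mod 8 = 1" by simp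
  then have "8 dvd h \<or> 8 dvd h - 1" by presburger
  then have "8 dvd h * (h - 1)" by auto
  moreover from this have "4 dvd h * (h - 1)" by (rule dvd_trans[rotated]) simp
  ultimately show "balanceable (triangular_grid h)"
    using balanceable_if_half_induced_and_half_cut[OF simple_graph_triangular_grid]
      exists_grid_half_induced exists_grid_half_cut by blast
next
  assume bal: "balanceable (triangular_grid h)"
  show "h mod 8 \<in> {0, 1}"
  proof (rule ccontr)
    assume "h mod 8 \<notin> {0, 1}"
    then have "h mod 8 = 4 \<or> h mod 8 = 5" using assms(2) by auto
    then have "\<exists>r. h * (h - 1) = 8 * r + 4"
    proof
      assume "h mod 8 = 4"
      then obtain q where "h = 8 * q + 4" by (metis mult_div_mod_eq)
      then have "h * (h - 1) = 8 * (8 * (q * q) + 7 * q + 1) + 4" by (simp add: algebra_simps)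
      then show ?thesis by blast
    next
      assume "h mod 8 = 5"
      then obtain q where "h = 8 * q + 5" by (metis mult_div_mod_eq)
      then have "h * (h - 1) = 8 * (8 * (q * q) + 9 * q + 2) + 4" by (simp add: algebra_simps)
      then show ?thesis by blast
    qed
    then obtain r where r: "h * (h - 1) = 8 * r + 4" by blast
    \<comment> \<open>Half of this number is odd, while every cut of the grid is even.\<close>
    have "card (edges (triangular_grid h)) = 4 * (3 * r + 1) + 2"
      using card_edges_triangular_grid[of h] unfolding r by simp
    then have mod4: "card (edges (triangular_grid h)) mod 4 = 2"
      by presburger
    then have "even (card (edges (triangular_grid h)))" by presburger
    then have "\<not> balanceable (triangular_grid h)"
    proof (intro not_balanceable_if_no_half_cut simple_graph_triangular_grid)
      fix X
      show "2 * card {e \<in> edges (triangular_grid h). \<not> e \<subseteq> X \<and> e \<inter> X \<noteq> {}}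
          \<noteq> card (edges (triangular_grid h))"
        using even_card_grid_cut[of h X] mod4 by presburger
    qed
    then show False using bal by blast
  qed
qed

end
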